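(* Let $n>3$. The dynamics group $G_{156}$ of Wolfram rule $156$ on the circular graph with $n$ vertices is a subdirect product of symmetric groups. In particular, \[ G_{156}\subset\prod_{\ell=1}^{n}\left(\mathrm{Sym}_{n-1}^{(\ell)}\times\prod_{m=2}^{n-3}\mathrm{Sym}_m^{(\ell)}\right), \] and each generator $F_1,\dots,F_n$ of $G_{156}$ restricted to a factor is either trivial or a standard Coxeter generator: in the factor $\mathrm{Sym}_m^{(\ell)}$, the generator $F_j$ acts as the transposition $(i\;\,i+1)$ if $j\equiv\ell+i \pmod n$ for some $1\le i\le m-1$, and acts trivially otherwise.
   Context: Indices are taken modulo $n$. For $1\le i\le n$ let $F_i\colon\mathbb{F}_2^n\to\mathbb{F}_2^n$ (the local update function of Wolfram rule $156$) be the map that changes $y_i$ to $1-y_i$ if $y_{i-1}=1$ and $y_{i+1}=0$, leaves $y_i$ unchanged otherwise, and leaves all other coordinates unchanged. Each $F_i$ is a bijection, every state in $\mathbb{F}_2^n$ is periodic, and the dynamics group $G_{156}$ is the group of permutations of $\mathbb{F}_2^n$ generated by $F_1,\dots,F_n$. A group $G$ is a subdirect product of groups $G_1,\dots,G_r$ if it embeds in $G_1\times\cdots\times G_r$ so that the projection to each factor is onto. A $10$-block of a state $\mathbf{y}$ is a maximal (cyclic) subword of the form $1^i0^j$ with $i,j>0$. For a position $\ell$ and a length $m+1$, $\mathrm{Sym}_m^{(\ell)}$ denotes the symmetric group on the $m$ words $x_i=1^i0^{m+1-i}$, $1\le i\le m$, which are the possible forms of a $10$-block of length $m+1$ starting at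 position $\ell$; the superscript $(\ell)$ records that the update functions acting nontrivially on such a block are $F_{\ell+1},\dots,F_{\ell+m-1}$, where $F_{\ell+i}$ swaps $x_i$ and $x_{i+1}$. Empty products are trivial. *)

theory Defs
  imports "HOL-Algebra.Algebra" "HOL-Number_Theory.Cong" "HOL-Library.Z2"
begin

text \<open>
  A state is a vector over the field with two elements, indexed by the residues modulo \<open>n\<close>, which
  are represented by \<open>0, \<dots>, n - 1\<close>.  Every access to a coordinate \<open>i\<close> goes through \<open>i mod n\<close>, so
  that vertices and positions may also be numbered \<open>1, \<dots>, n\<close>.
\<close>

definition states :: "nat \<Rightarrow> (nat \<Rightarrow> bit) set" where
  "states n = {..<n} \<rightarrow>\<^sub>E UNIV"

text \<open>The index \<open>i + n - 1\<close> stands for \<open>i - 1\<close>, avoiding truncated subtraction at \<open>i = 0\<close>.\<close>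

definition update156 :: "nat \<Rightarrow> nat \<Rightarrow> (nat \<Rightarrow> bit) \<Rightarrow> (nat \<Rightarrow> bit)" where
  "update156 n i =
     (\<lambda>y \<in> states n.
        if y ((i + n - 1) mod n) = 1 \<and> y ((i + 1) mod n) = 0
        then y(i mod n := 1 - y (i mod n)) else y)"

definition dynamics_group156 :: "nat \<Rightarrow> ((nat \<Rightarrow> bit) \<Rightarrow> (nat \<Rightarrow> bit)) monoid" where
  "dynamics_group156 n =
     (BijGroup (states n))\<lparr>carrier := generate (BijGroup (states n)) (update156 n ` {1..n})\<rparr>"

definition subdirect_embedding ::
    "('a, 'c) monoid_scheme \<Rightarrow> 'i set \<Rightarrow> ('i \<Rightarrow> ('b, 'd) monoid_scheme) \<Rightarrow> ('a \<Rightarrow> 'i \<Rightarrow> 'b) \<Rightarrow> bool" where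
  "subdirect_embedding G I H \<phi> \<longleftrightarrow>
     \<phi> \<in> mon G (product_group I H) \<and> (\<forall>k\<in>I. (\<lambda>g. \<phi> g k) \<in> epi G (H k))"

definition subword :: "nat \<Rightarrow> (nat \<Rightarrow> bit) \<Rightarrow> nat \<Rightarrow> nat \<Rightarrow> bit list" where
  "subword n y p k = map (\<lambda>t. y ((p + t) mod n)) [0..<k]"

definition is_10_word :: "bit list \<Rightarrow> bool" where
  "is_10_word w \<longleftrightarrow> (\<exists>i>0. \<exists>j>0. w = replicate i 1 @ replicate j 0)"

text \<open>
  \<open>block10 n y p w\<close>: the word \<open>w\<close>, read cyclically in \<open>y\<close> from position \<open>p\<close> on, is a 10-block of \<open>y\<close>.
  Maximality: no strictly longer cyclic subword of that form, starting at \<open>q\<close> and of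
  length \<open>k \<le> n\<close>, covers it; \<open>d\<close> is the offset of \<open>p\<close> inside that subword.
\<close>

definition block10 :: "nat \<Rightarrow> (nat \<Rightarrow> bit) \<Rightarrow> nat \<Rightarrow> bit list \<Rightarrow> bool" where
  "block10 n y p w \<longleftrightarrow>
     length w \<le> n \<and> subword n y p (length w) = w \<and> is_10_word w \<and>
     \<not> (\<exists>q d k. [p = q + d] (mod n) \<and> d + length w \<le> k \<and> length w < k \<and> k \<le> n \<and>
                is_10_word (subword n y q k))"

definition xword :: "nat \<Rightarrow> nat \<Rightarrow> bit list" where
  "xword m i = replicate i 1 @ replicate (m + 1 - i) 0"

definition xwords :: "nat \<Rightarrow> bit list set" where
  "xwords m = xword m ` {1..m}"

definition Sym_words :: "nat \<Rightarrow> (bit list \<Rightarrow> bit list) monoid" where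
  "Sym_words m = BijGroup (xwords m)"

text \<open>The transposition \<open>(i i+1)\<close>, meaningful for \<open>1 \<le> i \<le> m - 1\<close>.\<close>

definition coxeter_gen :: "nat \<Rightarrow> nat \<Rightarrow> bit list \<Rightarrow> bit list" where
  "coxeter_gen m i = restrict (transpose (xword m i) (xword m (i + 1))) (xwords m)"

text \<open>
  The pair \<open>(p, m)\<close> indexes the factor for 10-blocks of length \<open>m + 1\<close> starting at \<open>p\<close>.
  There are no 10-blocks of length \<open>n - 1\<close>, and for \<open>m = 1\<close> the symmetric group is trivial.
\<close>

definition factors156 :: "nat \<Rightarrow> (nat \<times> nat) set" where
  "factors156 n = {1..n} \<times> ({n - 1} \<union> {2..n - 3})"

text \<open>
  The component \<open>(p, m)\<close> of \<open>\<phi>\<close> is the restriction of the action on states to the 10-blocks of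
  length \<open>m + 1\<close> starting at \<open>p\<close>.
\<close>

definition acts_on_blocks ::
    "nat \<Rightarrow> (((nat \<Rightarrow> bit) \<Rightarrow> (nat \<Rightarrow> bit)) \<Rightarrow> nat \<times> nat \<Rightarrow> bit list \<Rightarrow> bit list) \<Rightarrow> bool" where
  "acts_on_blocks n \<phi> \<longleftrightarrow>
     (\<forall>g \<in> carrier (dynamics_group156 n). \<forall>(p, m) \<in> factors156 n. \<forall>y \<in> states n. \<forall>w \<in> xwords m.
        block10 n y p w \<longrightarrow> block10 n (g y) p (\<phi> g (p, m) w))"

end

theory Submission
  imports Defs
begin

text \<open>
  Rule 156 flips a position only between a \<open>1\<close> on its left and a \<open>0\<close> on its right. Such a flip happens only
  inside a 10-block \<open>1^i 0^j\<close> and moves its inner boundary by one step; the places where a block ends and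
  the next one starts are never touched (\<open>update156_block_at\<close>). Therefore the positions and
  lengths of the 10-blocks of a state are invariant, and the generator at offset \<open>r\<close> from the start of a
  block of length \<open>m + 1\<close> exchanges the words \<open>x_r\<close> and \<open>x_(r+1)\<close> if \<open>1 \<le> r < m\<close>, and fixes all words otherwise.
  This does not depend on the rest of the state.

  Consequently every group element \<open>g\<close> induces a permutation of the words \<open>x_1, \<dots>, x_m\<close> for each start
  \<open>p\<close> and each length \<open>m + 1\<close> (\<open>block_perm_exists\<close>). It is unique as soon as each word occurs as a
  block of some state, that is, for \<open>m = n - 1\<close> and for \<open>m \<le> n - 3\<close>
  (\<open>block_at_exists\<close>, \<open>block_perm_unique\<close>). Uniqueness turns the assignment into a
  homomorphism \<open>\<phi>\<close> to the product of the symmetric groups.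

  Each projection is onto because its image contains all adjacent transpositions
  (\<open>coxeter_gens_generate\<close>). The map \<open>\<phi>\<close> is injective because a nonconstant state is covered by its
  blocks (\<open>covered_by_block\<close>) while the constant states are fixed; the only length of a block that
  does not occur among the factors is 2, and there is just one word of that length
  (\<open>block_perms_determine_element\<close>).
\<close>

section \<open>Ten-blocks by coordinates\<close>

lemma length_xword: "i \<le> m \<Longrightarrow> length (xword m i) = m + 1"
  by (simp add: xword_def)

lemma nth_xword: "i \<le> m \<Longrightarrow> t \<le> m \<Longrightarrow> xword m i ! t = (if t < i then 1 else 0)"
  by (auto simp: xword_def nth_append)

lemma inj_on_xword: "inj_on (xword m) {1..m}"
proof (rule inj_onI)
  fix i j assume ij: "i \<in> {1..m}" "j \<in> {1..m}" and eq: "xword m i = xword m j"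
  have "i \<le> j" if "xword m i = xword m j" "i \<le> m" "j \<le> m" for i j
    using nth_xword[of i m j] nth_xword[of j m j] that by (auto split: if_splits)
  from this[of i j] this[of j i] ij eq show "i = j" by simp
qed

lemma is_10_word_nth:
  "is_10_word w \<longleftrightarrow> (\<exists>a>0. a < length w \<and> (\<forall>t<length w. w ! t = (if t < a then 1 else 0)))"
proof
  assume "is_10_word w"
  then obtain i j where "i > 0" "j > 0" "w = replicate i 1 @ replicate j 0"
    by (auto simp: is_10_word_def)
  then show "\<exists>a>0. a < length w \<and> (\<forall>t<length w. w ! t = (if t < a then 1 else 0))"
    by (intro exI[of _ i]) (auto simp: nth_append)
next
  assume "\<exists>a>0. a < length w \<and> (\<forall>t<length w. w ! t = (if t < a then 1 else 0))"
  then obtain a where a: "a > 0" "a < length w" "\<forall>t<length w. w ! t = (if t < a then 1 else 0)"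
    by blast
  then have "w = replicate a 1 @ replicate (length w - a) 0"
    by (intro nth_equalityI) (auto simp: nth_append)
  with a show "is_10_word w"
    unfolding is_10_word_def by (metis zero_less_diff)
qed

lemma is_10_word_subword:
  "is_10_word (subword n y q k) \<longleftrightarrow>
     (\<exists>a>0. a < k \<and> (\<forall>t<k. y ((q + t) mod n) = (if t < a then 1 else 0)))"
  by (auto simp: is_10_word_nth subword_def)

text \<open>
  The block occupies the positions \<open>s + 1, \<dots>, s + m + 1\<close> and has the form \<open>1^i 0^(m + 1 - i)\<close>. Indexing it by
  the position \<open>s\<close> in front of it avoids subtraction: maximality is the condition that the neighbours at
  \<open>s\<close> and \<open>s + m + 2\<close> carry \<open>0\<close> and \<open>1\<close>. A block that fills the whole circle
  (\<open>m = n - 1\<close>) is its own neighbour, and then the two conditions follow from its first and last letter.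
\<close>

definition block_at :: "nat \<Rightarrow> (nat \<Rightarrow> bit) \<Rightarrow> nat \<Rightarrow> nat \<Rightarrow> nat \<Rightarrow> bool" where
  "block_at n y s m i \<longleftrightarrow> 1 \<le> i \<and> i \<le> m \<and> m < n \<and> y (s mod n) = 0 \<and>
     (\<forall>t\<le>m. y ((s + 1 + t) mod n) = (if t < i then 1 else 0)) \<and> y ((s + m + 2) mod n) = 1"

lemma subword_eq_xword:
  assumes "i \<le> m"
  shows "subword n y p (m + 1) = xword m i \<longleftrightarrow>
    (\<forall>t\<le>m. y ((p + t) mod n) = (if t < i then 1 else 0))"
proof -
  have "subword n y p (m + 1) = xword m i \<longleftrightarrow>
      (\<forall>t<m + 1. y ((p + t) mod n) = xword m i ! t)"
    using length_xword[OF assms] by (auto simp: list_eq_iff_nth_eq subword_def simp del: upt_Suc)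
  then show ?thesis using assms by (auto simp: nth_xword less_Suc_eq_le)
qed

text \<open>
  A word \<open>1^i 0^j\<close> with \<open>i, j > 0\<close> that does not fill the circle is maximal exactly when it cannot be prolonged by one letter, and a
  letter can be put in front iff it is \<open>1\<close>, and behind iff it is \<open>0\<close>. The equivalence also covers
  \<open>m + 2 = n\<close>, where both sides are false: the one remaining letter would have to be
  \<open>0\<close> and \<open>1\<close> at once, and whichever it is, the word can be prolonged.
\<close>

lemma block10_iff_block_at:
  assumes i: "1 \<le> i" "i \<le> m"
  shows "block10 n y (s + 1) (xword m i) \<longleftrightarrow> block_at n y s m i"
proof
  assume B: "block10 n y (s + 1) (xword m i)"
  have mn: "m < n" using B i by (simp add: block10_def length_xword)
  have val: "y ((s + 1 + t) mod n) = (if t < i then 1 else 0)" if "t \<le> m" for t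
    using B i that subword_eq_xword[of i m n y "s + 1"] by (simp add: block10_def length_xword)
  have max: "\<not> is_10_word (subword n y q k)"
    if "[s + 1 = q + d] (mod n)" "d + (m + 1) \<le> k" "m + 1 < k" "k \<le> n" for q d k
    using B i that by (simp add: block10_def length_xword)
  have "y (s mod n) = 0 \<and> y ((s + m + 2) mod n) = 1"
  proof (cases "m + 1 = n")
    case True
    have "(s + 1 + m) mod n = s mod n" "(s + m + 2) mod n = (s + 1 + 0) mod n"
      using True by (metis add.assoc add.commute mod_add_self2,
        metis True add.assoc add.commute add.right_neutral mod_add_self2 one_add_one)
    then show ?thesis using val[of m] val[of 0] i by simp
  next
    case False
    with mn have lt: "m + 1 < n" by simp
    have l: "y (s mod n) = 0"
    proof (rule ccontr)
      assume "y (s mod n) \<noteq> 0"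
      then have "y ((s + t) mod n) = (if t < i + 1 then 1 else 0)" if "t < m + 2" for t
        using val[of "t - 1"] that by (cases t) auto
      then have "is_10_word (subword n y s (m + 2))"
        using i unfolding is_10_word_subword by (intro exI[of _ "i + 1"]) auto
      then show False using max[of s 1 "m + 2"] lt by simp
    qed
    have r: "y ((s + m + 2) mod n) = 1"
    proof (rule ccontr)
      assume *: "y ((s + m + 2) mod n) \<noteq> 1"
      have "y ((s + 1 + t) mod n) = (if t < i then 1 else 0)" if "t < m + 2" for t
      proof (cases "t = m + 1")
        case True
        then show ?thesis using * i by (simp add: ac_simps)
      qed (use val[of t] that in auto)
      then have "is_10_word (subword n y (s + 1) (m + 2))"
        using i unfolding is_10_word_subword by (intro exI[of _ i]) auto
      then show False using max[of "s + 1" 0 "m + 2"] lt by simp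
    qed
    from l r show ?thesis by blast
  qed
  then show "block_at n y s m i" using i mn val by (simp add: block_at_def)
next
  assume B: "block_at n y s m i"
  have val: "y ((s + 1 + t) mod n) = (if t < i then 1 else 0)" if "t \<le> m" for t
    using B that by (simp add: block_at_def)
  have "subword n y (s + 1) (m + 1) = xword m i"
    using subword_eq_xword[of i m n y "s + 1"] i val by blast
  moreover have "is_10_word (xword m i)"
    unfolding is_10_word_def xword_def using i by (intro exI[of _ i] conjI exI[of _ "m + 1 - i"]) auto
  moreover have "\<not> is_10_word (subword n y q k)"
    if c: "[s + 1 = q + d] (mod n)" and k: "d + (m + 1) \<le> k" "m + 1 < k" "k \<le> n" for q d k
  proof
    assume "is_10_word (subword n y q k)"
    then obtain a where a: "\<forall>t<k. y ((q + t) mod n) = (if t < a then 1 else 0)"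
      by (auto simp: is_10_word_subword)
    show False
    \<comment> \<open>The longer word contains either the position before the block or the position after it.\<close>
    proof (cases d)
      case 0
      have e: "(s + 1 + t) mod n = (q + t) mod n" for t
        using c 0 cong_add_rcancel_nat[of "s + 1" t q n] by (simp add: cong_def)
      have "y ((q + (m + 1)) mod n) = 1" "y ((q + m) mod n) = 0"
        using B e[of "m + 1"] e[of m] val[of m] i by (simp_all add: block_at_def ac_simps)
      with a[rule_format, of "m + 1"] a[rule_format, of m] k show False by (simp split: if_splits)
    next
      case (Suc e)
      have "[s + 1 = (q + e) + 1] (mod n)" using c Suc by simp
      then have "[s = q + e] (mod n)" using cong_add_rcancel_nat by blast
      then have "y ((q + e) mod n) = 0" "y ((q + d) mod n) = 1"
        using B c val[of 0] i by (auto simp: block_at_def cong_def)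
      with a[rule_format, of e] a[rule_format, of d] k Suc show False by (simp split: if_splits)
    qed
  qed
  ultimately show "block10 n y (s + 1) (xword m i)"
    using B i by (auto simp: block10_def length_xword block_at_def)
qed

section \<open>How one update moves a block\<close>

lemma update156_cong: "[j = k] (mod n) \<Longrightarrow> n > 0 \<Longrightarrow> update156 n j = update156 n k"
proof -
  assume c: "[j = k] (mod n)" and n: "n > 0"
  have "j mod n = k mod n" "(j + n - 1) mod n = (k + n - 1) mod n" "(j + 1) mod n = (k + 1) mod n"
    using c n cong_add_rcancel_nat[of j "n - 1" k n] cong_add_rcancel_nat[of j 1 k n]
    by (auto simp: cong_def)
  then show ?thesis by (simp only: update156_def)
qed

lemma update156_nth:
  assumes "y \<in> states n" "n > 0"
  shows "update156 n (s + 1) y x =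
    (if x = (s + 1) mod n \<and> y (s mod n) = 1 \<and> y ((s + 2) mod n) = 0
     then 1 - y x else y x)"
proof -
  have "(s + 1 + n - 1) mod n = s mod n" "s + 1 + 1 = s + 2" by simp_all
  then show ?thesis
    unfolding update156_def restrict_apply'[OF assms(1)] by (simp only: fun_upd_apply split: if_split) simp
qed

lemma mod_add_left_inj:
  assumes "a < n" "b < (n::nat)"
  shows "(s + a) mod n = (s + b) mod n \<longleftrightarrow> a = b"
  using assms cong_add_lcancel_nat[of s a b n] by (simp add: cong_def)

text \<open>
  The core of the argument. An update flips the position \<open>s + 1 + r\<close> only if its left neighbour is \<open>1\<close> and
  its right neighbour is \<open>0\<close>. In a block \<open>1^i 0^(m + 1 - i)\<close> this is possible only at the last \<open>1\<close>
  (\<open>r + 1 = i\<close>) and at the first \<open>0\<close> (\<open>r = i\<close>), which exchanges the words numbered \<open>r\<close> and \<open>r + 1\<close>.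
  Neither an end of the block nor one of the two positions next to it can flip,
  because a neighbour has the wrong value there, so the block never moves or changes length.
\<close>

lemma update156_block_at:
  assumes y: "y \<in> states n" and B: "block_at n y s m i" and r: "r < n"
  shows "block_at n (update156 n (s + 1 + r) y) s m
           (if 1 \<le> r \<and> r < m then transpose r (r + 1) i else i)"
proof -
  let ?y' = "update156 n (s + 1 + r) y"
  define flip where "flip \<longleftrightarrow> y ((s + r) mod n) = 1 \<and> y ((s + r + 2) mod n) = 0"
  have im: "1 \<le> i" "i \<le> m" "m < n" and l: "y (s mod n) = 0" and rt: "y ((s + m + 2) mod n) = 1"
    and val: "\<And>t. t \<le> m \<Longrightarrow> y ((s + 1 + t) mod n) = (if t < i then 1 else 0)"
    using B by (auto simp: block_at_def)
  have upd: "?y' x = (if x = (s + 1 + r) mod n \<and> flip then 1 - y x else y x)" for x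
    using update156_nth[OF y, of "s + r" x] r by (simp add: flip_def ac_simps)
  show ?thesis
  proof (cases "flip \<and> r \<le> m")
    case False
    \<comment> \<open>Unless the block fills the circle, these two offsets are the positions next to it.\<close>
    have "\<not> flip \<or> (m < r \<and> r \<noteq> m + 1 \<and> r \<noteq> n - 1)"
    proof -
      have "\<not> flip" if "r = m + 1" using that val[of m] im by (simp add: flip_def ac_simps)
      moreover have "\<not> flip" if "r = n - 1"
      proof -
        have "(s + r + 2) mod n = (s + 1 + 0) mod n"
          using that r by (metis (no_types, lifting) Suc_1 Suc_pred' add.assoc add.commute
              add_0 add_Suc_right less_nat_zero_code mod_add_self2 nat_neq_iff plus_1_eq_Suc)
        then show ?thesis using val[of 0] im by (simp add: flip_def)
      qed
      ultimately show ?thesis using False by auto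
    qed
    moreover have "\<not> (1 \<le> r \<and> r < m \<and> (i = r \<or> i = r + 1))" if "\<not> flip"
    proof
      assume *: "1 \<le> r \<and> r < m \<and> (i = r \<or> i = r + 1)"
      then have "y ((s + r) mod n) = 1" "y ((s + r + 2) mod n) = 0"
        using val[of "r - 1"] val[of "r + 1"] by (auto simp: ac_simps)
      with that show False by (simp add: flip_def)
    qed
    ultimately have idx: "(if 1 \<le> r \<and> r < m then transpose r (r + 1) i else i) = i"
      and far: "\<not> flip \<or> (m + 1 < r \<and> r + 1 < n)"
      using r by auto
    have "?y' ((s + a) mod n) = y ((s + a) mod n)" if "a \<le> m + 2" for a
      using far mod_add_left_inj[of a n "1 + r" s] im that unfolding upd by (auto simp: ac_simps)
    from this[of 0] this[of "m + 2"] this[of "1 + t" for t]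
    have "?y' (s mod n) = y (s mod n)" "?y' ((s + m + 2) mod n) = y ((s + m + 2) mod n)"
      "\<And>t. t \<le> m \<Longrightarrow> ?y' ((s + 1 + t) mod n) = y ((s + 1 + t) mod n)"
      by (auto simp: ac_simps)
    then show ?thesis using B unfolding idx by (simp add: block_at_def)
  next
    case True
    have "r \<noteq> 0" using True l by (auto simp: flip_def intro!: gr0I)
    moreover have "r \<noteq> m" using True rt by (auto simp: flip_def)
    ultimately have rm: "1 \<le> r" "r < m" using True by auto
    have "y ((s + 1 + (r - 1)) mod n) = 1" "y ((s + 1 + (r + 1)) mod n) = 0"
      using True rm by (simp_all add: flip_def ac_simps)
    then have "r - 1 < i" "\<not> r + 1 < i"
      using val[of "r - 1"] val[of "r + 1"] rm by (auto simp: le_diff_conv split: if_splits)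
    then have "i = r \<or> i = r + 1" using rm by linarith
    then have tr: "t < transpose r (r + 1) i \<longleftrightarrow> (if t = r then \<not> t < i else t < i)"
        "transpose r (r + 1) i \<in> {1..m}" for t
      using rm im by (auto simp: transpose_def)
    have L: "s mod n \<noteq> (s + 1 + r) mod n"
      using mod_add_left_inj[of 0 n "1 + r" s] rm im by (simp add: ac_simps)
    have R: "(s + m + 2) mod n \<noteq> (s + 1 + r) mod n"
    proof (cases "m + 1 = n")
      case True
      then have "(s + m + 2) mod n = (s + 1 + 0) mod n"
        by (metis add.assoc add.commute add.right_neutral mod_add_self2 one_add_one)
      then show ?thesis using mod_add_left_inj[of 0 n r "s + 1"] r rm by simp
    next
      case False
      then show ?thesis
        using mod_add_left_inj[of "m + 1" n r "s + 1"] r rm im by (simp add: ac_simps)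
    qed
    have I: "(s + 1 + t) mod n = (s + 1 + r) mod n \<longleftrightarrow> t = r" if "t \<le> m" for t
      using mod_add_left_inj[of t n r "s + 1"] r that im by simp
    have "block_at n ?y' s m (transpose r (r + 1) i)"
      unfolding block_at_def
    proof (intro conjI allI impI)
      show "1 \<le> transpose r (r + 1) i" "transpose r (r + 1) i \<le> m" using tr(2) by auto
      show "?y' (s mod n) = 0" "?y' ((s + m + 2) mod n) = 1" using L R l rt by (simp_all only: upd if_False simp_thms)
      show "?y' ((s + 1 + t) mod n) = (if t < transpose r (r + 1) i then 1 else 0)" if "t \<le> m" for t
        unfolding upd I[OF that] val[OF that] tr(1) using True by simp
    qed (fact im)
    with rm show ?thesis by simp
  qed
qed

section \<open>Blocks cover every nonconstant state\<close>

lemma boundary_exists: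
  fixes Y :: "nat \<Rightarrow> bit"
  assumes "Y a = 0" "Y b = 1" "a < b"
  obtains s where "a \<le> s" "s < b" "Y s = 0" "Y (s + 1) = 1"
proof -
  have "\<exists>s. a \<le> s \<and> s < b \<and> Y s = 0 \<and> Y (s + 1) = 1"
    using less_imp_le[OF assms(3)] assms(2)
  proof (induction b rule: dec_induct)
    case base
    with assms(1) show ?case by simp
  next
    case (step b)
    show ?case
    proof (cases "Y b = 1")
      case True
      with step.IH show ?thesis using less_SucI by blast
    next
      case False
      with step show ?thesis by (intro exI[of _ b]) simp
    qed
  qed
  then show thesis using that by blast
qed

text \<open>
  A nonconstant cyclic word has a position where \<open>0\<close> is followed by \<open>1\<close>. Cutting it at all of
  these leaves pieces without the factor \<open>01\<close> that begin with \<open>1\<close> and end with \<open>0\<close>: the blocks.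
  Hence every position \<open>c\<close> lies in a block.
\<close>

lemma covered_by_block:
  assumes "y (a mod n) = 0" "y (b mod n) = 1" "n > 0"
  obtains s m i t where "block_at n y s m i" "t \<le> m" "[c = s + 1 + t] (mod n)"
proof -
  define Y where "Y k = y (k mod n)" for k
  have per: "Y (k + n) = Y k" "Y (k mod n) = Y k" for k by (simp_all add: Y_def)
  define start where "start s \<longleftrightarrow> Y s = 0 \<and> Y (s + 1) = 1" for s
  have start_per: "start (k + n) = start k" for k
    unfolding start_def using per(1)[of k] per(1)[of "k + 1"] by (simp add: ac_simps)
  have "Y (a mod n) = 0" "Y (b mod n + n) = 1" "a mod n < b mod n + n"
    using assms per by (auto simp: Y_def trans_less_add2)
  then obtain s0 where "Y s0 = 0" "Y (s0 + 1) = 1" by (rule boundary_exists)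
  then have "start s0" by (simp add: start_def)
  have start_mod: "start (s0 mod n)"
    using \<open>start s0\<close> unfolding start_def Y_def by (simp add: mod_Suc_eq)
  \<comment> \<open>Shifting by one period leaves room for a start to the left of the position.\<close>
  define C where "C = c + n"
  have "s0 mod n + 1 \<le> C" using mod_less_divisor[OF assms(3), of s0] by (simp add: C_def)
  define s where "s = (GREATEST s. start s \<and> s + 1 \<le> C)"
  have s: "start s \<and> s + 1 \<le> C"
    unfolding s_def by (rule GreatestI_nat[of _ "s0 mod n" C]) (use start_mod \<open>s0 mod n + 1 \<le> C\<close> in auto)
  have s_max: "x \<le> s" if "start x" "x + 1 \<le> C" for x
    unfolding s_def by (rule Greatest_le_nat[of _ _ C]) (use that in auto)
  \<comment> \<open>The piece between the last start before the position and the next one.\<close>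
  define e where "e = (LEAST e. s < e \<and> start e)"
  have e: "s < e \<and> start e"
    unfolding e_def by (rule LeastI[of _ "s + n"]) (use s assms(3) start_per in auto)
  have e_le: "e \<le> s + n"
    unfolding e_def by (rule Least_le) (use s assms(3) start_per in auto)
  have e_min: "\<not> start x" if "s < x" "x < e" for x
    using that not_less_Least[of x "\<lambda>e. s < e \<and> start e"] by (auto simp flip: e_def)
  have "e \<noteq> s + 1" using s e by (auto simp: start_def)
  then have e2: "s + 2 \<le> e" using e by simp
  have Ce: "C \<le> e" using s_max[of e] e by (rule_tac ccontr) auto
  define m where "m = e - s - 1"
  have em: "e = s + 1 + m" using e2 by (simp add: m_def)
  define i where "i = (LEAST i. Y (s + 1 + i) = 0)"
  have Ye: "Y (s + 1 + m) = 0" using e by (simp add: start_def em)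
  have i0: "Y (s + 1 + i) = 0" unfolding i_def by (rule LeastI[of _ m]) (rule Ye)
  have im: "i \<le> m" unfolding i_def by (rule Least_le) (rule Ye)
  have ones: "Y (s + 1 + t) = 1" if "t < i" for t
    using not_less_Least[OF that[unfolded i_def]] by simp
  have "i \<noteq> 0"
  proof
    assume "i = 0"
    with i0 have "Y (s + 1) = 0" by simp
    with s show False by (simp add: start_def)
  qed
  then have i1: "1 \<le> i" by simp
  have zeros: "Y (s + 1 + t) = 0" if "i \<le> t" "t \<le> m" for t
    using that
  proof (induction t rule: dec_induct)
    case base
    show ?case using i0 .
  next
    case (step t)
    then have "\<not> start (s + 1 + t)" using e_min[of "s + 1 + t"] by (simp add: em)
    moreover have "Y (s + 1 + t) = 0" using step by simp
    ultimately have "Y (s + 1 + t + 1) \<noteq> 1" unfolding start_def by blast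
    then show ?case by simp
  qed
  have "block_at n y s m i"
    unfolding block_at_def
  proof (intro conjI allI impI)
    show "m < n" using e_le em by simp
    show "y (s mod n) = 0" using s by (simp add: start_def Y_def)
    show "y ((s + 1 + t) mod n) = (if t < i then 1 else 0)" if "t \<le> m" for t
      using ones[of t] zeros[of t] that by (simp add: Y_def)
    show "y ((s + m + 2) mod n) = 1" using e by (simp add: start_def Y_def em ac_simps)
  qed (fact i1 im)+
  moreover have "C - (s + 1) \<le> m" using Ce em by simp
  moreover have "s + 1 + (C - (s + 1)) = C" using s by simp
  then have "[c = s + 1 + (C - (s + 1))] (mod n)" by (simp only:) (simp add: C_def cong_def)
  ultimately show thesis by (rule that[of s m i "C - (s + 1)"])
qed

text \<open>
  For \<open>m = n - 1\<close> the word itself is a state; for \<open>m + 3 \<le> n\<close> at least two positions lie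
  outside the block, enough to put a \<open>1\<close> behind it and a \<open>0\<close> in front of it. So each word of a factor
  occurs as a block, which makes the induced permutation unique.
\<close>

lemma block_at_exists:
  assumes i: "1 \<le> i" "i \<le> m" and m: "m = n - 1 \<or> m + 3 \<le> n" and n: "n > 0"
  obtains y where "y \<in> states n" "block_at n y s m i"
proof -
  \<comment> \<open>The offset of a position from the first letter of the block.\<close>
  define f where "f c = (c + (n - (s + 1) mod n)) mod n" for c
  have f: "f ((s + 1 + t) mod n) = t mod n" for t
  proof -
    define q x where "q = (s + 1) div n" and "x = (s + 1) mod n"
    have "s + 1 = n * q + x" "x < n" using n by (simp_all add: q_def x_def)
    then have "(s + 1 + t) + (n - x) = t + n * (q + 1)" by (simp add: algebra_simps)
    then have "(s + 1 + t) + (n - (s + 1) mod n) = t + n * (q + 1)" unfolding x_def .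
    then have "((s + 1 + t) + (n - (s + 1) mod n)) mod n = t mod n" by (metis mod_mult_self2)
    then show ?thesis unfolding f_def mod_add_left_eq .
  qed
  have fs: "f (s mod n) = n - 1" using f[of "n - 1"] n by simp
  define y :: "nat \<Rightarrow> bit" where
    "y = (\<lambda>c\<in>{..<n}. if f c < i \<or> f c = m + 1 then 1 else 0)"
  have y: "y (c mod n) = (if f (c mod n) < i \<or> f (c mod n) = m + 1 then 1 else 0)" for c
    using n by (simp add: y_def)
  have "y (s mod n) = 0" using i m n by (auto simp: y fs)
  moreover have "y ((s + 1 + t) mod n) = (if t < i then 1 else 0)" if "t \<le> m" for t
    using f[of t] i m n that by (auto simp: y)
  moreover have "y ((s + 1 + (m + 1)) mod n) = 1"
    unfolding y f using i m n by (cases "m + 1 = n") auto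
  ultimately have "block_at n y s m i" using i m n by (auto simp: block_at_def)
  moreover have "y \<in> states n" by (simp add: states_def y_def)
  ultimately show thesis using that by blast
qed

section \<open>Adjacent transpositions generate the symmetric group\<close>

lemma restrict_transpose_Bij:
  "a \<in> S \<Longrightarrow> b \<in> S \<Longrightarrow> restrict (transpose a b) S \<in> Bij S"
  by (simp add: Bij_def bij_betw_restrict_eq)

lemma compose_restrict:
  "g ` S \<subseteq> S \<Longrightarrow> compose S (restrict f S) (restrict g S) = restrict (f \<circ> g) S"
  by (auto simp: compose_def fun_eq_iff)

text \<open>
  Conjugation gives \<open>(a b+1) = (a b)(b b+1)(a b)\<close>, so by induction on the distance all transpositions lie in
  the subgroup, and these generate. This is what makes the projections to the factors surjective.
\<close>

lemma coxeter_gens_generate: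
  assumes H: "subgroup H (Sym_words m)"
    and gens: "\<And>i. 1 \<le> i \<Longrightarrow> i < m \<Longrightarrow> coxeter_gen m i \<in> H"
  shows "H = carrier (Sym_words m)"
proof
  show "H \<subseteq> carrier (Sym_words m)" using H by (rule subgroup.subset)
next
  let ?S = "xwords m" and ?x = "xword m"
  have inS: "?x a \<in> ?S" if "1 \<le> a" "a \<le> m" for a using that by (auto simp: xwords_def)
  have neq: "?x a \<noteq> ?x b" if "1 \<le> a" "a < b" "b \<le> m" for a b
    using inj_onD[OF inj_on_xword[of m], of a b] that by auto
  have mult: "compose ?S f g \<in> H" if "f \<in> H" "g \<in> H" for f g
    using subgroup.m_closed[OF H that] subgroup.subset[OF H] that
    by (auto simp: Sym_words_def BijGroup_def subset_iff)
  have transp: "restrict (transpose (?x a) (?x b)) ?S \<in> H" if "a < b" "1 \<le> a" "b \<le> m" for a b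
  proof -
    from that(1) have "Suc a \<le> b" by simp
    then show ?thesis using that(3)
    proof (induction b rule: dec_induct)
      case base
      have "coxeter_gen m a \<in> H" using gens that(2) base by simp
      then show ?case by (simp only: coxeter_gen_def Suc_eq_plus1)
    next
      case (step b)
      let ?T = "transpose (?x a) (?x b)" and ?U = "transpose (?x b) (?x (Suc b))"
      have T: "restrict ?T ?S \<in> H" using step.IH step.prems by (simp only: Suc_leD)
      have "coxeter_gen m b \<in> H" using gens step that(2) by simp
      then have U: "restrict ?U ?S \<in> H" by (simp only: coxeter_gen_def Suc_eq_plus1)
      have S: "?x a \<in> ?S" "?x b \<in> ?S" "?x (Suc b) \<in> ?S" using inS step that(2) by auto
      have "?T \<circ> ?U \<circ> ?T = transpose (?x a) (?x (Suc b))"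
        using neq[of a "Suc b"] neq[of b "Suc b"] step that(2) by (intro transpose_comp_triple) auto
      moreover have "compose ?S (compose ?S (restrict ?T ?S) (restrict ?U ?S)) (restrict ?T ?S)
          = restrict (?T \<circ> ?U \<circ> ?T) ?S"
        using S by (simp add: compose_restrict)
      ultimately show ?case using mult[OF mult[OF T U] T] by (simp only:)
    qed
  qed
  have transp': "restrict (transpose u v) ?S \<in> H" if "u \<in> ?S" "v \<in> ?S" "u \<noteq> v" for u v
  proof -
    from that obtain a b where "u = ?x a" "v = ?x b" "1 \<le> a" "a \<le> m" "1 \<le> b" "b \<le> m"
      by (auto simp: xwords_def)
    moreover from this that have "a \<noteq> b" by blast
    ultimately have "a < b \<and> 1 \<le> a \<and> b \<le> m \<or> b < a \<and> 1 \<le> b \<and> a \<le> m"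
      and "u = ?x a" "v = ?x b" by auto
    then show ?thesis
      using transp[of a b] transp[of b a] transpose_commute[of u v] by metis
  qed
  have finite_S: "finite ?S" by (simp add: xwords_def)
  have perm: "restrict p ?S \<in> H" if "p permutes ?S" for p
    using that finite_S
  proof (induction p rule: permutes_induct)
    show "restrict id ?S \<in> H"
      using subgroup.one_closed[OF H] by (simp add: Sym_words_def BijGroup_def id_def)
  next
    fix a b p
    assume *: "a \<in> ?S" "b \<in> ?S" "a \<noteq> b" "restrict p ?S \<in> H" "p permutes ?S"
    then have "compose ?S (restrict (transpose a b) ?S) (restrict p ?S) \<in> H"
      by (intro mult transp')
    then show "restrict (transpose a b \<circ> p) ?S \<in> H"
      using * by (simp add: compose_restrict permutes_image)
  qed
  show "carrier (Sym_words m) \<subseteq> H"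
  proof
    fix f assume "f \<in> carrier (Sym_words m)"
    then have f: "f \<in> extensional ?S" "bij_betw f ?S ?S"
      by (auto simp: Sym_words_def BijGroup_def Bij_def)
    define p where "p u = (if u \<in> ?S then f u else u)" for u
    have "bij_betw p ?S ?S" using f(2) by (simp add: p_def cong: bij_betw_cong)
    then have "p permutes ?S" by (rule bij_imp_permutes) (simp add: p_def)
    moreover have "restrict p ?S = f"
      using f(1) by (auto simp: p_def fun_eq_iff extensional_def)
    ultimately show "f \<in> H" using perm by metis
  qed
qed

section \<open>The dynamics group\<close>

text \<open>
  The update at \<open>j\<close> leaves the two neighbours that decide about the flip as they are.
\<close>

lemma update156_involution:
  assumes y: "y \<in> states n" and n: "n > 1" and j: "j \<ge> 1"
  shows "update156 n j y \<in> states n" "update156 n j (update156 n j y) = y"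
proof -
  obtain s where s: "j = s + 1" using j by (metis add.commute le_Suc_ex plus_1_eq_Suc)
  note upd = update156_nth[of _ n s, folded s]
  show F: "update156 n j y \<in> states n"
    using y n by (auto simp: upd states_def PiE_iff extensional_def)
  have "s mod n \<noteq> (s + 1) mod n" "(s + 2) mod n \<noteq> (s + 1) mod n"
    using mod_add_left_inj[of 0 n 1 s] mod_add_left_inj[of 1 n 0 "s + 1"] n by simp_all
  then have z: "update156 n j y (s mod n) = y (s mod n)"
      "update156 n j y ((s + 2) mod n) = y ((s + 2) mod n)"
    using upd[OF y] n by (simp_all del: add_2_eq_Suc' add: s)
  have "update156 n j (update156 n j y) x = y x" for x
    unfolding upd[OF F, of x, OF order.strict_trans[OF zero_less_one n]] z
      upd[OF y, of x, OF order.strict_trans[OF zero_less_one n]] by (cases "y x") auto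
  then show "update156 n j (update156 n j y) = y" by blast
qed

lemma update156_Bij:
  assumes "n > 1" "j \<ge> 1"
  shows "update156 n j \<in> Bij (states n)"
proof -
  have "bij_betw (update156 n j) (states n) (states n)"
    by (rule bij_betwI[where g = "update156 n j"]) (use update156_involution assms in auto)
  moreover have "update156 n j \<in> extensional (states n)"
    unfolding update156_def by (rule restrict_extensional)
  ultimately show ?thesis by (simp add: Bij_def)
qed

lemma inv_update156:
  assumes "n > 1" "j \<ge> 1"
  shows "inv\<^bsub>BijGroup (states n)\<^esub> (update156 n j) = update156 n j"
proof (rule group.inv_equality[OF group_BijGroup])
  show "update156 n j \<otimes>\<^bsub>BijGroup (states n)\<^esub> update156 n j = \<one>\<^bsub>BijGroup (states n)\<^esub>"
    using update156_Bij[OF assms] update156_involution[of _ n j] assms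
    by (auto simp: BijGroup_def compose_def fun_eq_iff)
qed (use update156_Bij[OF assms] in \<open>simp_all add: BijGroup_def\<close>)

lemma
  assumes "n > 1"
  shows group_dynamics_group156: "group (dynamics_group156 n)"
    and dynamics_group156_subset_Bij: "carrier (dynamics_group156 n) \<subseteq> Bij (states n)"
    and mult_dynamics_group156: "\<And>g h. g \<in> carrier (dynamics_group156 n) \<Longrightarrow>
      h \<in> carrier (dynamics_group156 n) \<Longrightarrow> g \<otimes>\<^bsub>dynamics_group156 n\<^esub> h = compose (states n) g h"
    and update156_in_dynamics_group156: "\<And>j. j \<in> {1..n} \<Longrightarrow> update156 n j \<in> carrier (dynamics_group156 n)"
proof -
  let ?B = "BijGroup (states n)" and ?F = "update156 n ` {1..n}"
  have F: "?F \<subseteq> carrier ?B" using update156_Bij[OF assms] by (auto simp: BijGroup_def)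
  have sub: "subgroup (generate ?B ?F) ?B"
    by (rule group.generate_is_subgroup[OF group_BijGroup F])
  show "group (dynamics_group156 n)"
    unfolding dynamics_group156_def by (rule subgroup.subgroup_is_group[OF sub group_BijGroup])
  show S: "carrier (dynamics_group156 n) \<subseteq> Bij (states n)"
    using subgroup.subset[OF sub] by (simp add: dynamics_group156_def BijGroup_def)
  show "g \<otimes>\<^bsub>dynamics_group156 n\<^esub> h = compose (states n) g h"
    if "g \<in> carrier (dynamics_group156 n)" "h \<in> carrier (dynamics_group156 n)" for g h
    using S that by (auto simp: dynamics_group156_def BijGroup_def)
  show "update156 n j \<in> carrier (dynamics_group156 n)" if "j \<in> {1..n}" for j
    using that by (auto simp: dynamics_group156_def intro: generate.incl)
qed

text \<open>
  The generators are involutions, so the inverses in the definition of the generated subgroup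
  contribute no further case.
\<close>

lemma dynamics_group156_induct [consumes 2, case_names id update compose]:
  assumes g: "g \<in> carrier (dynamics_group156 n)" and n: "n > 1"
    and id: "P (\<lambda>y\<in>states n. y)"
    and update: "\<And>j. j \<in> {1..n} \<Longrightarrow> P (update156 n j)"
    and compose: "\<And>g h. g \<in> carrier (dynamics_group156 n) \<Longrightarrow> h \<in> carrier (dynamics_group156 n) \<Longrightarrow>
      P g \<Longrightarrow> P h \<Longrightarrow> P (compose (states n) g h)"
  shows "P g"
proof -
  let ?B = "BijGroup (states n)" and ?F = "update156 n ` {1..n}"
  have carrier: "carrier (dynamics_group156 n) = generate ?B ?F" by (simp add: dynamics_group156_def)
  have "g \<in> generate ?B ?F" using g by (simp add: carrier)
  then show ?thesis
  proof induction
    case one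
    have "\<one>\<^bsub>?B\<^esub> = (\<lambda>y\<in>states n. y)" by (simp add: BijGroup_def)
    then show ?case using id by (simp only:)
  next
    case (incl h)
    then show ?case using update by auto
  next
    case (inv h)
    then show ?case using update inv_update156[OF n] by auto
  next
    case (eng g h)
    then have "g \<otimes>\<^bsub>?B\<^esub> h = compose (states n) g h"
      using dynamics_group156_subset_Bij[OF n] by (auto simp: carrier BijGroup_def)
    with eng compose show ?case by (simp add: carrier)
  qed
qed

section \<open>The action on blocks\<close>

text \<open>
  The permutation \<open>\<pi>\<close> records what \<open>g\<close> does to all blocks at position \<open>p\<close> of length \<open>m + 1\<close>, in every state
  at once; in particular it may not depend on the state around the block.
\<close>

definition block_perm ::
    "nat \<Rightarrow> ((nat \<Rightarrow> bit) \<Rightarrow> (nat \<Rightarrow> bit)) \<Rightarrow> nat \<Rightarrow> nat \<Rightarrow> (bit list \<Rightarrow> bit list) \<Rightarrow> bool" where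
  "block_perm n g p m \<pi> \<longleftrightarrow> \<pi> \<in> Bij (xwords m) \<and>
     (\<forall>y \<in> states n. \<forall>w \<in> xwords m. block10 n y p w \<longrightarrow> block10 n (g y) p (\<pi> w))"

lemma block_perm_id: "block_perm n (\<lambda>y\<in>states n. y) p m (\<lambda>w\<in>xwords m. w)"
  by (simp add: block_perm_def id_Bij)

lemma block_perm_compose:
  assumes "block_perm n g p m \<pi>" "block_perm n h p m \<sigma>" "h \<in> Bij (states n)"
  shows "block_perm n (compose (states n) g h) p m (compose (xwords m) \<pi> \<sigma>)"
  using assms compose_Bij[of \<pi> "xwords m" \<sigma>] Bij_imp_funcset[of \<sigma> "xwords m"]
    Bij_imp_funcset[of h "states n"]
  by (auto simp: block_perm_def compose_def Pi_iff)

lemma block_perm_update156: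
  assumes r: "r < n"
  shows "block_perm n (update156 n (s + 1 + r)) (s + 1) m
    (if 1 \<le> r \<and> r < m then coxeter_gen m r else (\<lambda>w\<in>xwords m. w))" (is "block_perm _ ?F _ _ ?\<pi>")
  unfolding block_perm_def
proof (intro conjI ballI impI)
  show "?\<pi> \<in> Bij (xwords m)"
    by (auto simp: coxeter_gen_def id_Bij xwords_def intro!: restrict_transpose_Bij)
next
  fix y w assume y: "y \<in> states n" and w: "w \<in> xwords m" and B: "block10 n y (s + 1) w"
  from w obtain i where i: "w = xword m i" "1 \<le> i" "i \<le> m" by (auto simp: xwords_def)
  define i' where "i' = (if 1 \<le> r \<and> r < m then transpose r (r + 1) i else i)"
  have i': "1 \<le> i'" "i' \<le> m" using i by (auto simp: i'_def transpose_def)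
  have "block_at n (?F y) s m i'"
    unfolding i'_def using B i block10_iff_block_at by (intro update156_block_at[OF y _ r]) simp
  moreover have "?\<pi> w = xword m i'"
  proof (cases "1 \<le> r \<and> r < m")
    case True
    have "xword m i = xword m k \<longleftrightarrow> i = k" if "1 \<le> k" "k \<le> m" for k
      using inj_on_eq_iff[OF inj_on_xword, of i m k] i that by simp
    with True show ?thesis using i w by (auto simp: coxeter_gen_def i'_def transpose_def)
  next
    case False
    then show ?thesis using i w by (auto simp: i'_def)
  qed
  ultimately show "block10 n (?F y) (s + 1) (?\<pi> w)" using block10_iff_block_at[OF i'] by simp
qed

text \<open>
  The effect of an update on a block is known in terms of the offset \<open>r\<close> of its vertex from the start of
  the block, so vertices are rewritten in this form.
\<close>

lemma obtain_offset:
  fixes n :: nat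
  assumes "n > 0"
  obtains r where "r < n" "[j = s + 1 + r] (mod n)"
proof
  \<comment> \<open>Modulo \<open>n\<close>, multiplication by \<open>n - 1\<close> is negation.\<close>
  have "s + 1 + (j + (n - 1) * (s + 1)) = j + n * (s + 1)"
    by (cases n) (use assms in \<open>simp_all add: algebra_simps\<close>)
  then show "[j = s + 1 + (j + (n - 1) * (s + 1)) mod n] (mod n)"
    unfolding cong_def mod_add_right_eq by (metis mod_mult_self2)
qed (use assms in simp)

lemma block_perm_exists:
  assumes g: "g \<in> carrier (dynamics_group156 n)" and n: "n > 1" and p: "p \<ge> 1"
  shows "\<exists>\<pi>. block_perm n g p m \<pi>"
  using g n
proof (induction rule: dynamics_group156_induct)
  case id
  show ?case using block_perm_id by blast
next
  case (update j)
  obtain s where s: "p = s + 1" using p by (metis add.commute le_Suc_ex plus_1_eq_Suc)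
  obtain r where "r < n" "[j = s + 1 + r] (mod n)" using obtain_offset[of n j s] n by auto
  then show ?case using block_perm_update156[of r n s m] update156_cong[of j "s + 1 + r" n] n s by auto
next
  case (compose g h)
  then show ?case using block_perm_compose dynamics_group156_subset_Bij[OF n] by (meson subset_iff)
qed

lemma block_perm_unique:
  assumes \<pi>: "block_perm n g p m \<pi>" and \<sigma>: "block_perm n g p m \<sigma>"
    and p: "p \<ge> 1" and m: "m = n - 1 \<or> m + 3 \<le> n" and n: "n > 0"
  shows "\<pi> = \<sigma>"
proof (rule extensionalityI[of _ "xwords m"])
  show "\<pi> \<in> extensional (xwords m)" "\<sigma> \<in> extensional (xwords m)"
    using \<pi> \<sigma> by (auto simp: block_perm_def Bij_def)
next
  fix w assume w: "w \<in> xwords m"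
  then obtain i where i: "w = xword m i" "1 \<le> i" "i \<le> m" by (auto simp: xwords_def)
  obtain s where s: "p = s + 1" using p by (metis add.commute le_Suc_ex plus_1_eq_Suc)
  obtain y where y: "y \<in> states n" "block_at n y s m i" using block_at_exists[OF i(2,3) m n] .
  then have "block10 n y p w" using block10_iff_block_at i s by simp
  then have B: "block10 n (g y) p (\<pi> w)" "block10 n (g y) p (\<sigma> w)"
    using \<pi> \<sigma> y w by (auto simp: block_perm_def)
  have "\<pi> w \<in> xwords m" "\<sigma> w \<in> xwords m"
    using \<pi> \<sigma> w by (auto simp: block_perm_def dest!: Bij_imp_funcset)
  then have "length (\<pi> w) = m + 1" "length (\<sigma> w) = m + 1"
    by (auto simp: xwords_def length_xword)
  with B show "\<pi> w = \<sigma> w" by (simp add: block10_def)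
qed

section \<open>Faithfulness and the embedding\<close>

lemma constant_state_fixed:
  assumes g: "g \<in> carrier (dynamics_group156 n)" and n: "n > 1" and y: "y \<in> states n"
    and const: "\<And>a b. y (a mod n) = y (b mod n)"
  shows "g y = y"
  using g n
proof (induction rule: dynamics_group156_induct)
  case (update j)
  show ?case using y const[of "j + n - 1" "j + 1"] by (auto simp: update156_def)
qed (use y in \<open>simp_all add: compose_def\<close>)

lemma states_eqI:
  assumes "y \<in> states n" "z \<in> states n" "\<And>c. y (c mod n) = z (c mod n)"
  shows "y = z"
proof (rule extensionalityI[of _ "{..<n}"])
  show "y c = z c" if "c \<in> {..<n}" for c using assms(3)[of c] that by simp
qed (use assms in \<open>auto simp: states_def PiE_def\<close>)

text \<open>
  A constant state is fixed by the whole group, and a nonconstant state is the union of its blocks, so an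
  element is known once its action on blocks of every length is known. The lengths
  \<open>m + 1\<close> that are not covered by a factor cause no loss: for \<open>m = 1\<close> there is only the word \<open>10\<close>, and
  for \<open>m = n - 2\<close> a single position would be left over, which has to be both the \<open>0\<close> before the
  block and the \<open>1\<close> after it.
\<close>

lemma block_perms_determine_element:
  assumes g: "g \<in> carrier (dynamics_group156 n)" and h: "h \<in> carrier (dynamics_group156 n)"
    and n: "n > 3"
    and eq: "\<And>p m. (p, m) \<in> factors156 n \<Longrightarrow> \<exists>\<pi>. block_perm n g p m \<pi> \<and> block_perm n h p m \<pi>"
  shows "g = h"
proof (rule extensionalityI[of _ "states n"])
  have n1: "n > 1" and n0: "n > 0" using n by simp_all
  have Bij: "g \<in> Bij (states n)" "h \<in> Bij (states n)"
    using g h dynamics_group156_subset_Bij[OF n1] by auto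
  then show "g \<in> extensional (states n)" "h \<in> extensional (states n)" by (auto simp: Bij_def)
  fix y assume y: "y \<in> states n"
  show "g y = h y"
  proof (cases "\<forall>a b. y (a mod n) = y (b mod n)")
    case True
    then show ?thesis using constant_state_fixed[OF g n1 y] constant_state_fixed[OF h n1 y] by metis
  next
    case False
    then obtain a b where ab: "y (a mod n) = 0" "y (b mod n) = 1" by (metis bit_not_one_iff)
    have gh: "g y \<in> states n" "h y \<in> states n" using Bij y Bij_imp_funcset by blast+
    show ?thesis
    proof (rule states_eqI[OF gh])
      fix c
      obtain s' m i t where B': "block_at n y s' m i" and t: "t \<le> m" and c': "[c = s' + 1 + t] (mod n)"
        using covered_by_block[OF ab n0, of c] by metis
      \<comment> \<open>The factors are indexed by positions between 1 and \<open>n\<close>.\<close>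
      define s where "s = s' mod n"
      have shift: "(s + x) mod n = (s' + x) mod n" for x by (simp add: s_def mod_add_left_eq)
      have B: "block_at n y s m i"
        using B' shift[of 0] shift[of "m + 2"] shift[of "1 + x" for x]
        by (simp add: block_at_def add.assoc)
      have c: "[c = s + 1 + t] (mod n)" using c' shift[of "1 + t"] by (simp add: cong_def add.assoc)
      have im: "1 \<le> i" "i \<le> m" "m < n" and
        ends: "y (s mod n) = 0" "y ((s + m + 2) mod n) = 1" using B by (auto simp: block_at_def)
      have p: "s + 1 \<in> {1..n}" using n0 by (simp add: s_def Suc_le_eq)
      have "m \<noteq> n - 2"
      proof
        assume "m = n - 2"
        then have "s + m + 2 = s + n" using n by simp
        then have "(s + m + 2) mod n = s mod n" by (simp only: mod_add_self2)
        with ends show False by simp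
      qed
      then have mcases: "m = 1 \<or> (s + 1, m) \<in> factors156 n"
        using im p by (auto simp: factors156_def)
      have "\<exists>\<pi>. block_perm n g (s + 1) m \<pi> \<and> block_perm n h (s + 1) m \<pi>"
      proof (cases "(s + 1, m) \<in> factors156 n")
        case True
        then show ?thesis by (rule eq)
      next
        case False
        with mcases have "m = 1" by simp
        have trivial: "\<pi> = (\<lambda>w\<in>xwords m. w)" if "\<pi> \<in> Bij (xwords m)" for \<pi>
        proof (rule extensionalityI[of _ "xwords m"])
          show "\<pi> \<in> extensional (xwords m)" using that by (rule Bij_imp_extensional)
          show "\<pi> w = (\<lambda>w\<in>xwords m. w) w" if "w \<in> xwords m" for w
            using funcset_mem[OF Bij_imp_funcset[OF \<open>\<pi> \<in> Bij (xwords m)\<close>] that] that \<open>m = 1\<close>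
            by (simp add: xwords_def)
        qed simp
        obtain \<pi> \<sigma> where "block_perm n g (s + 1) m \<pi>" "block_perm n h (s + 1) m \<sigma>"
          using block_perm_exists[OF g n1] block_perm_exists[OF h n1] by (metis le_add2)
        moreover from this have "\<pi> = \<sigma>"
          using trivial[of \<pi>] trivial[of \<sigma>] by (simp only: block_perm_def)
        ultimately show ?thesis by blast
      qed
      then obtain \<pi> where \<pi>: "block_perm n g (s + 1) m \<pi>" "block_perm n h (s + 1) m \<pi>" by blast
      have w: "xword m i \<in> xwords m" using im by (simp add: xwords_def)
      then have "\<pi> (xword m i) \<in> xwords m"
        using \<pi> by (auto simp: block_perm_def dest!: Bij_imp_funcset)
      then obtain k where k: "\<pi> (xword m i) = xword m k" "1 \<le> k" "k \<le> m" by (auto simp: xwords_def)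
      have "block10 n y (s + 1) (xword m i)" using B block10_iff_block_at[OF im(1,2)] by simp
      then have "block10 n (g y) (s + 1) (xword m k)" "block10 n (h y) (s + 1) (xword m k)"
        using \<pi> y w k(1) unfolding block_perm_def by metis+
      then have "block_at n (g y) s m k" "block_at n (h y) s m k"
        using block10_iff_block_at[OF k(2,3)] by simp_all
      then show "g y (c mod n) = h y (c mod n)"
        using t c by (simp add: block_at_def cong_def)
    qed
  qed
qed

theorem theorem5p6:
  fixes n :: nat
  assumes "n > 3"
  shows "\<exists>\<phi>. subdirect_embedding (dynamics_group156 n) (factors156 n) (\<lambda>(p, m). Sym_words m) \<phi> \<and>
           acts_on_blocks n \<phi> \<and>
           (\<forall>j \<in> {1..n}. \<forall>(p, m) \<in> factors156 n.
              (\<forall>i \<in> {1..m - 1}. [j = p + i] (mod n) \<longrightarrow>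
                 \<phi> (update156 n j) (p, m) = coxeter_gen m i) \<and>
              ((\<nexists>i. i \<in> {1..m - 1} \<and> [j = p + i] (mod n)) \<longrightarrow>
                 \<phi> (update156 n j) (p, m) = \<one>\<^bsub>Sym_words m\<^esub>))"
proof -
  let ?G = "dynamics_group156 n" and ?I = "factors156 n"
  let ?H = "\<lambda>(p :: nat, m). Sym_words m"
  have n1: "n > 1" and n0: "n > 0" using assms by simp_all
  define \<phi> where "\<phi> g = (\<lambda>(p, m) \<in> ?I. THE \<pi>. block_perm n g p m \<pi>)" for g
  have factor: "p \<ge> 1" "m < n" "m = n - 1 \<or> m + 3 \<le> n" if "(p, m) \<in> ?I" for p m
    using that assms by (auto simp: factors156_def)
  have \<phi>_eq: "\<phi> g (p, m) = \<pi>" if "block_perm n g p m \<pi>" "(p, m) \<in> ?I" for g p m \<pi>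
    using that block_perm_unique[OF _ _ factor(1,3)[OF that(2)] n0]
    unfolding \<phi>_def by (auto intro!: the_equality)
  have \<phi>: "block_perm n g p m (\<phi> g (p, m))" if "g \<in> carrier ?G" "(p, m) \<in> ?I" for g p m
    using block_perm_exists[OF that(1) n1 factor(1)[OF that(2)]] \<phi>_eq[OF _ that(2)] by metis
  have \<phi>_carrier: "\<phi> g (p, m) \<in> carrier (Sym_words m)" if "g \<in> carrier ?G" "(p, m) \<in> ?I" for g p m
    using \<phi>[OF that] by (simp add: block_perm_def Sym_words_def BijGroup_def)
  have \<phi>_mult: "\<phi> (g \<otimes>\<^bsub>?G\<^esub> h) (p, m) = \<phi> g (p, m) \<otimes>\<^bsub>Sym_words m\<^esub> \<phi> h (p, m)"
    if g: "g \<in> carrier ?G" and h: "h \<in> carrier ?G" and k: "(p, m) \<in> ?I" for g h p m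
  proof -
    have "block_perm n (g \<otimes>\<^bsub>?G\<^esub> h) p m (compose (xwords m) (\<phi> g (p, m)) (\<phi> h (p, m)))"
      unfolding mult_dynamics_group156[OF n1 g h]
      using block_perm_compose \<phi>[OF g k] \<phi>[OF h k] dynamics_group156_subset_Bij[OF n1] h by blast
    then have "\<phi> (g \<otimes>\<^bsub>?G\<^esub> h) (p, m) = compose (xwords m) (\<phi> g (p, m)) (\<phi> h (p, m))"
      using k by (rule \<phi>_eq)
    then show ?thesis
      using \<phi>_carrier[OF g k] \<phi>_carrier[OF h k] by (simp add: Sym_words_def BijGroup_def)
  qed
  have hom: "(\<lambda>g. \<phi> g (p, m)) \<in> hom ?G (Sym_words m)" if "(p, m) \<in> ?I" for p m
    using \<phi>_carrier \<phi>_mult that by (auto intro!: homI)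

  have gen: "\<phi> (update156 n j) (p, m) =
      (if 1 \<le> r \<and> r < m then coxeter_gen m r else \<one>\<^bsub>Sym_words m\<^esub>)"
    if k: "(p, m) \<in> ?I" and r: "r < n" and j: "[j = p + r] (mod n)" for j p m r
  proof -
    obtain s where s: "p = s + 1" using factor(1)[OF k] by (metis add.commute le_Suc_ex plus_1_eq_Suc)
    show ?thesis
      using block_perm_update156[OF r, of s m] \<phi>_eq[OF _ k] update156_cong[OF j n0] s
      by (simp add: Sym_words_def BijGroup_def)
  qed
  have gens: "\<phi> (update156 n j) (p, m) = coxeter_gen m i"
    if "(p, m) \<in> ?I" "i \<in> {1..m - 1}" "[j = p + i] (mod n)" for j p m i
    using gen[OF that(1) _ that(3)] factor(2)[OF that(1)] that(2) by auto
  have gens_trivial: "\<phi> (update156 n j) (p, m) = \<one>\<^bsub>Sym_words m\<^esub>"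
    if k: "(p, m) \<in> ?I" and no: "\<nexists>i. i \<in> {1..m - 1} \<and> [j = p + i] (mod n)" for j p m
  proof -
    obtain s where s: "p = s + 1" using factor(1)[OF k] by (metis add.commute le_Suc_ex plus_1_eq_Suc)
    obtain r where r: "r < n" "[j = p + r] (mod n)" using obtain_offset[OF n0, of j s] s by metis
    then have "\<not> (1 \<le> r \<and> r < m)" using no by auto
    then show ?thesis using gen[OF k r] by (simp only: if_False)
  qed

  have surj: "(\<lambda>g. \<phi> g (p, m)) ` carrier ?G = carrier (Sym_words m)" if k: "(p, m) \<in> ?I" for p m
  proof (rule coxeter_gens_generate)
    have "group_hom ?G (Sym_words m) (\<lambda>g. \<phi> g (p, m))"
      using group_dynamics_group156[OF n1] group_BijGroup[of "xwords m"] hom[OF k]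
      by (simp add: group_hom_def group_hom_axioms_def Sym_words_def)
    then show "subgroup ((\<lambda>g. \<phi> g (p, m)) ` carrier ?G) (Sym_words m)"
      by (rule group_hom.img_is_subgroup)
  next
    fix i assume i: "1 \<le> i" "i < m"
    \<comment> \<open>The vertex acting on the block as the wanted transposition, numbered from 1 to \<open>n\<close>.\<close>
    obtain r where r: "r < n" "[p + i = 0 + 1 + r] (mod n)" using obtain_offset[OF n0, of "p + i" 0] by metis
    then have "[r + 1 = p + i] (mod n)" by (simp add: cong_sym)
    then have "\<phi> (update156 n (r + 1)) (p, m) = coxeter_gen m i" using gens[OF k] i by simp
    moreover have "update156 n (r + 1) \<in> carrier ?G"
      using r by (intro update156_in_dynamics_group156[OF n1]) simp
    ultimately show "coxeter_gen m i \<in> (\<lambda>g. \<phi> g (p, m)) ` carrier ?G" by (metis image_eqI)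
  qed

  have inj: "inj_on \<phi> (carrier ?G)"
  proof (rule inj_onI)
    fix g h assume g: "g \<in> carrier ?G" and h: "h \<in> carrier ?G" and eq: "\<phi> g = \<phi> h"
    show "g = h"
      using g h assms
    proof (rule block_perms_determine_element)
      fix p m assume "(p, m) \<in> ?I"
      then show "\<exists>\<pi>. block_perm n g p m \<pi> \<and> block_perm n h p m \<pi>"
        using \<phi>[OF g] \<phi>[OF h] eq by metis
    qed
  qed

  have "\<phi> \<in> hom ?G (product_group ?I ?H)"
  proof (rule homI)
    show "\<phi> g \<in> carrier (product_group ?I ?H)" if "g \<in> carrier ?G" for g
      using \<phi>_carrier[OF that] by (auto simp: PiE_iff \<phi>_def split: prod.splits)
    show "\<phi> (g \<otimes>\<^bsub>?G\<^esub> h) = \<phi> g \<otimes>\<^bsub>product_group ?I ?H\<^esub> \<phi> h"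
      if "g \<in> carrier ?G" "h \<in> carrier ?G" for g h
    proof (rule extensionalityI[of _ ?I])
      show "\<phi> (g \<otimes>\<^bsub>?G\<^esub> h) \<in> extensional ?I" by (simp add: \<phi>_def)
    qed (use \<phi>_mult[OF that] in auto)
  qed
  moreover have "(\<lambda>g. \<phi> g k) \<in> epi ?G (?H k)" if "k \<in> ?I" for k
    using hom surj that by (cases k) (simp add: epi_def)
  ultimately have emb: "subdirect_embedding ?G ?I ?H \<phi>"
    using inj by (simp add: subdirect_embedding_def mon_def)
  have "acts_on_blocks n \<phi>"
    using \<phi> unfolding acts_on_blocks_def block_perm_def by blast
  with emb show ?thesis using gens gens_trivial by (intro exI[of _ \<phi>]) blast
qed

end
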